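(* Let $G$ be a cubic graph with perfect matching $M$, embedded in a connected, closed, orientable surface, and let $D=D(G,M)$ be the associated link diagram. Then the Penrose-Kauffman polynomial $P(q)$ of $(G,M)$ is $$P(q)=\sum_S \chi(G_S,q),$$ where the sum is over all colorable states $S$ of $D$, and $\chi(G_S,q)$ is the chromatic polynomial of the component graph $G_S$ of $S$.
   Context: A cubic graph is a finite graph in which every vertex has degree 3 (multiple edges and loops allowed). A perfect matching $M$ is a set of edges such that every vertex is incident to exactly one edge of $M$. Tait $n$-colorings: a Tait $n$-coloring of $(G,M)$ is an assignment of colors from $\{1,\dots,n\}$ to the edges of $G$ not in $M$ such that for every $e\in M$ the two (non-$M$) edge-ends at one endpoint of $e$ have colors $i\ne j$ and the set of colors of the two (non-$M$) edge-ends at the other endpoint is the same set $\{i,j\}$. Penrose-Kauffman (PK) polynomial of $(G,M)$: the unique integral polynomial $P(q)$ whose value at every positive integer $n$ is the number of Tait $n$-colorings of $(G,M)$. Associated link diagram $D(G,M)$: fix an orientation of the surface. Each edge $e\in M$ with endpoints $u,v$ is replaced, in a small disk neighborhood of $e$, by a crossing of two arcs, each joining an edge-end at $u$ to an edge-end at $v$. Explicitly, if the counterclockwise cyclic order of edge-ends is $e,a,b$ at $u$ and $e,c,d$ at $v$, then the arcs of the crossing join $a$ to $c$ and $b$ to $d$. The crossing's over/under information is chosen so that the two dotted corners at the crossing (the corners swept by the over-arc when it is rotated counterclockwise until it reaches the under-arc) are the corner between $a$ and $b$ and the corner between $c$ and $d$. Smoothing the crossing means replacing the two crossing arcs by two disjoint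 parallel arcs (running alongside $e$) joining $a$ to $d$ and $b$ to $c$, so that the two dotted corners come to lie in the same region. States: a state $S$ of $D$ is the diagram obtained by smoothing some subset of the crossings of $D$ (possibly none or all). A component of $S$ is a closed curve obtained by travelling along $S$, going straight through remaining crossings. $S$ is colorable if for each $e\in M$ the two arcs of $S$ (crossing or parallel) that replace $e$ lie in different components of $S$; these two components are said to cross at $e$ if the arcs cross and to kiss at $e$ if the arcs are parallel. Component graph: $G_S$ has one vertex for each component of $S$ and a single edge between two vertices when the corresponding components cross or kiss. *)

theory Defs
  imports
    "Graph_Theory.Pair_Digraph"
    "HOL-Combinatorics.Orbits"
    "HOL-Computational_Algebra.Polynomial"
    "HOL-Library.FuncSet"
begin

section \<open>Cubic graphs, perfect matchings, embeddings\<close>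

text \<open>
  A multigraph with loops is a bidirected digraph: an arc \<open>a\<close> is an edge-end, situated at the
  vertex \<open>tail G a\<close>, and the other end of the same edge is \<open>arev a\<close>. An undirected edge is the
  two-element set of its ends. A loop has two distinct ends at the same vertex, so it counts twice
  in the degree.
\<close>

definition edge_of :: "('b \<Rightarrow> 'b) \<Rightarrow> 'b \<Rightarrow> 'b set" where
  "edge_of arev a = {a, arev a}"

definition edges :: "('a,'b) pre_digraph \<Rightarrow> ('b \<Rightarrow> 'b) \<Rightarrow> 'b set set" where
  "edges G arev = edge_of arev ` arcs G"

definition cubic_graph :: "('a,'b) pre_digraph \<Rightarrow> ('b \<Rightarrow> 'b) \<Rightarrow> bool" where
  "cubic_graph G arev \<longleftrightarrow>
     fin_digraph G \<and> bidirected_digraph G arev \<and> (\<forall>v\<in>verts G. out_degree G v = 3)"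

text \<open>Counting edge-ends rather than edges at a vertex excludes loops from a matching.\<close>

definition perfect_matching :: "('a,'b) pre_digraph \<Rightarrow> ('b \<Rightarrow> 'b) \<Rightarrow> 'b set set \<Rightarrow> bool" where
  "perfect_matching G arev M \<longleftrightarrow>
     M \<subseteq> edges G arev \<and> (\<forall>v\<in>verts G. \<exists>!a. a \<in> out_arcs G v \<and> edge_of arev a \<in> M)"

text \<open>
  An embedding in a connected closed oriented surface is given by its rotation system: \<open>rot a\<close> is
  the edge-end following \<open>a\<close> counterclockwise at the same vertex. Every embedding (cellular or not)
  determines a rotation system, and every rotation system arises in this way (for a disconnected
  graph, by connecting the surfaces of its components with tubes). The link diagram, its states and
  their components only depend on the rotation system.
\<close>

definition rotation_system :: "('a,'b) pre_digraph \<Rightarrow> ('b \<Rightarrow> 'b) \<Rightarrow> bool" where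
  "rotation_system G rot \<longleftrightarrow>
     rot permutes arcs G \<and> (\<forall>v\<in>verts G. cyclic_on rot (out_arcs G v))"


section \<open>Polynomials that count colorings\<close>

definition counting_poly :: "(nat \<Rightarrow> nat) \<Rightarrow> int poly" where
  "counting_poly f = (THE P. \<forall>n>0. poly P (int n) = int (f n))"

definition free_ends :: "('a,'b) pre_digraph \<Rightarrow> ('b \<Rightarrow> 'b) \<Rightarrow> 'b set set \<Rightarrow> 'b set" where
  "free_ends G arev M = {a \<in> arcs G. edge_of arev a \<notin> M}"

definition end_colors ::
  "('a,'b) pre_digraph \<Rightarrow> ('b \<Rightarrow> 'b) \<Rightarrow> 'b set set \<Rightarrow> ('b set \<Rightarrow> nat) \<Rightarrow> 'a \<Rightarrow> nat set" where
  "end_colors G arev M c v =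
     (\<lambda>a. c (edge_of arev a)) ` (out_arcs G v \<inter> free_ends G arev M)"

text \<open>
  At either endpoint of a matching edge there are exactly two ends of edges not in \<open>M\<close>, so a set of
  end colors \<open>{i, j}\<close> with \<open>i \<noteq> j\<close> says that one of them has color \<open>i\<close> and the other one
  color \<open>j\<close>.
\<close>

definition tait_colorings ::
  "('a,'b) pre_digraph \<Rightarrow> ('b \<Rightarrow> 'b) \<Rightarrow> 'b set set \<Rightarrow> nat \<Rightarrow> ('b set \<Rightarrow> nat) set" where
  "tait_colorings G arev M n =
     {c \<in> (edges G arev - M) \<rightarrow>\<^sub>E {1..n}.
        \<forall>e\<in>arcs G. edge_of arev e \<in> M \<longrightarrow>
          (\<exists>i j. i \<noteq> j \<and> end_colors G arev M c (tail G e) = {i, j}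
                    \<and> end_colors G arev M c (head G e) = {i, j})}"

definition PK_poly :: "('a,'b) pre_digraph \<Rightarrow> ('b \<Rightarrow> 'b) \<Rightarrow> 'b set set \<Rightarrow> int poly" where
  "PK_poly G arev M = counting_poly (\<lambda>n. card (tait_colorings G arev M n))"

definition proper_colorings :: "'a pair_pre_digraph \<Rightarrow> nat \<Rightarrow> ('a \<Rightarrow> nat) set" where
  "proper_colorings H n = {c \<in> pverts H \<rightarrow>\<^sub>E {1..n}. \<forall>(u, v)\<in>parcs H. c u \<noteq> c v}"

definition chromatic_poly :: "'a pair_pre_digraph \<Rightarrow> int poly" where
  "chromatic_poly H = counting_poly (\<lambda>n. card (proper_colorings H n))"


section \<open>The link diagram and its states\<close>

text \<open>
  A crossing \<open>(w, x, y, z)\<close> lists the four edge-ends around it in counterclockwise order, starting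
  with an end of the over-arc. The over-arc joins \<open>w\<close> to \<open>y\<close> and the under-arc \<open>x\<close> to \<open>z\<close>; the
  corners swept when the over-arc is rotated counterclockwise (the dotted corners) are the ones
  between \<open>w\<close> and \<open>x\<close> and between \<open>y\<close> and \<open>z\<close>. Smoothing merges these two corners.
\<close>

type_synonym 'b crossing = "'b \<times> 'b \<times> 'b \<times> 'b"

fun crossed_arcs :: "'b crossing \<Rightarrow> 'b set set" where
  "crossed_arcs (w, x, y, z) = {{w, y}, {x, z}}"

fun smoothed_arcs :: "'b crossing \<Rightarrow> 'b set set" where
  "smoothed_arcs (w, x, y, z) = {{w, z}, {x, y}}"

text \<open>
  With counterclockwise orders \<open>e, a, b\<close> at one endpoint of the matching edge and \<open>e, c, d\<close> at the
  other one, the ends around the small disk containing the edge are \<open>a, b, c, d\<close> in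
  counterclockwise order. Describing the edge by its other end \<open>arev e\<close> gives \<open>(c, d, a, b)\<close>, which
  is the same crossing.
\<close>

definition crossing_at :: "('b \<Rightarrow> 'b) \<Rightarrow> ('b \<Rightarrow> 'b) \<Rightarrow> 'b \<Rightarrow> 'b crossing" where
  "crossing_at arev rot e = (rot e, rot (rot e), rot (arev e), rot (rot (arev e)))"

text \<open>A state is specified by the set \<open>S \<subseteq> M\<close> of matching edges whose crossings are smoothed.\<close>

definition state_arcs :: "('b \<Rightarrow> 'b) \<Rightarrow> ('b \<Rightarrow> 'b) \<Rightarrow> 'b set set \<Rightarrow> 'b \<Rightarrow> 'b set set" where
  "state_arcs arev rot S e =
     (if edge_of arev e \<in> S then smoothed_arcs (crossing_at arev rot e)
      else crossed_arcs (crossing_at arev rot e))"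

definition state_step ::
  "('a,'b) pre_digraph \<Rightarrow> ('b \<Rightarrow> 'b) \<Rightarrow> ('b \<Rightarrow> 'b) \<Rightarrow> 'b set set \<Rightarrow> 'b set set \<Rightarrow> 'b rel" where
  "state_step G arev rot M S =
     {(a, b). a \<in> free_ends G arev M \<and> b = arev a} \<union>
     {(a, b). \<exists>e\<in>arcs G. edge_of arev e \<in> M \<and> {a, b} \<in> state_arcs arev rot S e}"

text \<open>A closed curve of a state is represented by the set of edge-ends on it.\<close>

definition components ::
  "('a,'b) pre_digraph \<Rightarrow> ('b \<Rightarrow> 'b) \<Rightarrow> ('b \<Rightarrow> 'b) \<Rightarrow> 'b set set \<Rightarrow> 'b set set \<Rightarrow> 'b set set" where
  "components G arev rot M S = free_ends G arev M // (state_step G arev rot M S)\<^sup>*"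

text \<open>One of the two arcs replacing \<open>e\<close> lies in \<open>C\<close> and the other one in \<open>C'\<close>.\<close>

definition arcs_lie_in ::
  "('b \<Rightarrow> 'b) \<Rightarrow> ('b \<Rightarrow> 'b) \<Rightarrow> 'b set set \<Rightarrow> 'b \<Rightarrow> 'b set \<Rightarrow> 'b set \<Rightarrow> bool" where
  "arcs_lie_in arev rot S e C C' \<longleftrightarrow>
     (\<exists>p\<in>state_arcs arev rot S e. \<exists>q\<in>state_arcs arev rot S e. p \<noteq> q \<and> p \<subseteq> C \<and> q \<subseteq> C')"

definition colorable ::
  "('a,'b) pre_digraph \<Rightarrow> ('b \<Rightarrow> 'b) \<Rightarrow> ('b \<Rightarrow> 'b) \<Rightarrow> 'b set set \<Rightarrow> 'b set set \<Rightarrow> bool" where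
  "colorable G arev rot M S \<longleftrightarrow>
     (\<forall>e\<in>arcs G. edge_of arev e \<in> M \<longrightarrow>
        (\<forall>C\<in>components G arev rot M S. \<forall>C'\<in>components G arev rot M S.
           arcs_lie_in arev rot S e C C' \<longrightarrow> C \<noteq> C'))"

definition cross_at ::
  "('b \<Rightarrow> 'b) \<Rightarrow> ('b \<Rightarrow> 'b) \<Rightarrow> 'b set set \<Rightarrow> 'b \<Rightarrow> 'b set \<Rightarrow> 'b set \<Rightarrow> bool" where
  "cross_at arev rot S e C C' \<longleftrightarrow> edge_of arev e \<notin> S \<and> arcs_lie_in arev rot S e C C'"

definition kiss_at ::
  "('b \<Rightarrow> 'b) \<Rightarrow> ('b \<Rightarrow> 'b) \<Rightarrow> 'b set set \<Rightarrow> 'b \<Rightarrow> 'b set \<Rightarrow> 'b set \<Rightarrow> bool" where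
  "kiss_at arev rot S e C C' \<longleftrightarrow> edge_of arev e \<in> S \<and> arcs_lie_in arev rot S e C C'"

text \<open>An undirected edge of the component graph is a pair of opposite arcs.\<close>

definition component_graph ::
  "('a,'b) pre_digraph \<Rightarrow> ('b \<Rightarrow> 'b) \<Rightarrow> ('b \<Rightarrow> 'b) \<Rightarrow> 'b set set \<Rightarrow> 'b set set \<Rightarrow>
   'b set pair_pre_digraph" where
  "component_graph G arev rot M S =
     \<lparr> pverts = components G arev rot M S,
       parcs = {(C, C'). C \<in> components G arev rot M S \<and> C' \<in> components G arev rot M S \<and>
                  (\<exists>e\<in>arcs G. edge_of arev e \<in> M \<and>
                     (cross_at arev rot S e C C' \<or> kiss_at arev rot S e C C'))} \<rparr>"


section \<open>The counting polynomials exist and are unique\<close>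

lemma counting_poly_eqI:
  assumes "\<And>n. n > 0 \<Longrightarrow> poly P (int n) = int (f n)"
  shows "counting_poly f = P"
  unfolding counting_poly_def
proof (rule the_equality)
  show "\<forall>n>0. poly P (int n) = int (f n)" using assms by simp
next
  fix Q assume Q: "\<forall>n>0. poly Q (int n) = int (f n)"
  have "int ` {0<..} \<subseteq> {x. poly (Q - P) x = 0}"
    using Q assms by auto
  moreover have "infinite (int ` {0<..})"
    by (subst finite_image_iff) (auto simp: inj_on_def infinite_Ioi)
  ultimately have "infinite {x. poly (Q - P) x = 0}"
    using finite_subset by blast
  then show "Q = P" using poly_roots_finite[of "Q - P"] by auto
qed

lemma count_kernel_poly:
  fixes g :: "'x \<Rightarrow> nat"
  assumes fin: "finite X"
  shows "\<exists>P :: int poly. \<forall>n. poly P (int n) =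
    int (card {f \<in> X \<rightarrow>\<^sub>E {1..n}. \<forall>x\<in>X. \<forall>y\<in>X. f x = f y \<longleftrightarrow> g x = g y})"
proof -
  obtain A where A: "A \<subseteq> X" "inj_on g A" "g ` A = g ` X"
    by (metis order_refl subset_image_inj)
  define r where "r x = inv_into A g (g x)" for x
  have r: "r x \<in> A" "g (r x) = g x" if "x \<in> X" for x
  proof -
    have "g x \<in> g ` A" using that A(3) by simp
    then show "r x \<in> A" "g (r x) = g x"
      by (simp_all add: r_def inv_into_into f_inv_into_f)
  qed
  have rA: "r x = x" if "x \<in> A" for x
    using that A(2) by (simp add: r_def)
  have req: "r x = r y" if "g x = g y" for x y
    using that by (simp add: r_def)
  define k where "k = card A"
  have finA: "finite A" using A(1) fin finite_subset by blast
  have "int (card {f \<in> X \<rightarrow>\<^sub>E {1..n}. \<forall>x\<in>X. \<forall>y\<in>X. f x = f y \<longleftrightarrow> g x = g y})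
     = poly (\<Prod>i<k. [:- int i, 1:]) (int n)" (is "int (card ?L) = _") for n
  proof -
    let ?R = "{h \<in> A \<rightarrow>\<^sub>E {1..n}. inj_on h A}"
    have "bij_betw (\<lambda>f. restrict f A) ?L ?R"
    proof (rule bij_betw_byWitness[where f' = "\<lambda>h. restrict (h \<circ> r) X"])
      show "\<forall>f\<in>?L. restrict (restrict f A \<circ> r) X = f"
      proof
        fix f assume "f \<in> ?L"
        then have f: "f \<in> extensional X" "\<And>x y. x \<in> X \<Longrightarrow> y \<in> X \<Longrightarrow> f x = f y \<longleftrightarrow> g x = g y"
          by (simp_all add: PiE_def)
        show "restrict (restrict f A \<circ> r) X = f"
        proof
          fix x
          show "restrict (restrict f A \<circ> r) X x = f x"
          proof (cases "x \<in> X")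
            case True
            then have "r x \<in> X" using r(1) A(1) by blast
            then have "f (r x) = f x" using f(2) r(2) True by blast
            then show ?thesis using True r(1) by simp
          next
            case False
            then show ?thesis using f(1) by (simp add: extensional_def)
          qed
        qed
      qed
      show "\<forall>h\<in>?R. restrict (restrict (h \<circ> r) X) A = h"
        using rA A(1) by (simp add: fun_eq_iff PiE_def extensional_def restrict_def subset_iff)
      show "(\<lambda>f. restrict f A) ` ?L \<subseteq> ?R"
      proof (rule image_subsetI)
        fix f assume "f \<in> ?L"
        then have f: "f \<in> X \<rightarrow>\<^sub>E {1..n}" "\<And>x y. x \<in> X \<Longrightarrow> y \<in> X \<Longrightarrow> f x = f y \<longleftrightarrow> g x = g y"
          by simp_all
        have "inj_on (restrict f A) A"
          using f(2) A(1,2) by (simp add: inj_on_def subset_iff)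
        moreover have "restrict f A \<in> A \<rightarrow>\<^sub>E {1..n}"
          using f(1) A(1) by (simp add: PiE_def Pi_def subset_iff)
        ultimately show "restrict f A \<in> ?R" by simp
      qed
      show "(\<lambda>h. restrict (h \<circ> r) X) ` ?R \<subseteq> ?L"
      proof (rule image_subsetI)
        fix h assume "h \<in> ?R"
        then have h: "h \<in> A \<rightarrow>\<^sub>E {1..n}" "inj_on h A" by simp_all
        have "restrict (h \<circ> r) X \<in> X \<rightarrow>\<^sub>E {1..n}"
          using h(1) r(1) by (simp add: PiE_def Pi_def)
        moreover have "h (r x) = h (r y) \<longleftrightarrow> g x = g y" if "x \<in> X" "y \<in> X" for x y
          using inj_on_eq_iff[OF h(2) r(1)[OF that(1)] r(1)[OF that(2)]]
            r(2)[OF that(1)] r(2)[OF that(2)] req[of x y] by metis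
        ultimately show "restrict (h \<circ> r) X \<in> ?L" by simp
      qed
    qed
    then have "card ?L = card ?R" by (rule bij_betw_same_card)
    also have "\<dots> = (\<Prod>i = 0..<k. n - i)"
      using card_inj_on_subset_funcset[OF finA, of "{1..n}" A] by (simp add: k_def)
    also have "int \<dots> = (\<Prod>i<k. int n - int i)"
    proof (cases "k \<le> n")
      case True
      then show ?thesis by (auto simp: atLeast0LessThan intro!: prod.cong)
    next
      case False
      then have "\<exists>x\<in>{..<k}. n - x = 0" "\<exists>x\<in>{..<k}. int n - int x = 0"
        by (auto intro!: bexI[of _ n])
      then have "(\<Prod>i = 0..<k. n - i) = 0" "(\<Prod>i<k. int n - int i) = 0"
        by (auto simp only: atLeast0LessThan prod_zero_iff finite_lessThan)
      then show ?thesis by (simp only: of_nat_0)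
    qed
    finally show ?thesis by (simp add: poly_prod)
  qed
  then show ?thesis by metis
qed

lemma ex_counting_poly:
  assumes fin: "finite X"
    and inv: "\<And>(f :: 'x \<Rightarrow> nat) (h :: nat \<Rightarrow> nat). inj_on h (f ` X) \<Longrightarrow> Q f \<Longrightarrow> Q (restrict (h \<circ> f) X)"
  shows "\<exists>P :: int poly. \<forall>n. poly P (int n) = int (card {f \<in> X \<rightarrow>\<^sub>E {1..n}. Q f})"
proof -
  define ker :: "('x \<Rightarrow> nat) \<Rightarrow> 'x rel" where
    "ker f = {(x, y). x \<in> X \<and> y \<in> X \<and> f x = f y}" for f
  define K where "K = ker ` {f. Q f}"
  have finK: "finite K"
    by (rule finite_subset[of _ "Pow (X \<times> X)"]) (auto simp: K_def ker_def fin)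
  have keq: "ker f = ker g \<longleftrightarrow> (\<forall>x\<in>X. \<forall>y\<in>X. f x = f y \<longleftrightarrow> g x = g y)" for f g
    unfolding ker_def by auto
  have Qk: "Q g" if "Q f" "ker f = ker g" "g \<in> extensional X" for f g
  proof -
    define h where "h = g \<circ> inv_into X f"
    have inX: "inv_into X f (f x) \<in> X" "f (inv_into X f (f x)) = f x" if "x \<in> X" for x
      using that by (auto intro: inv_into_into f_inv_into_f)
    have hf: "h (f x) = g x" if "x \<in> X" for x
      using inX[OF that] that \<open>ker f = ker g\<close> unfolding keq h_def by auto
    have "inj_on h (f ` X)"
      using hf \<open>ker f = ker g\<close> unfolding keq inj_on_def by auto
    from inv[OF this \<open>Q f\<close>] have "Q (restrict (h \<circ> f) X)" .
    also have "restrict (h \<circ> f) X = g"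
      using hf \<open>g \<in> extensional X\<close> by (auto simp: fun_eq_iff extensional_def restrict_def)
    finally show ?thesis .
  qed
  have "\<exists>P :: int poly. \<forall>n. poly P (int n) = int (card {f \<in> X \<rightarrow>\<^sub>E {1..n}. ker f = r})"
    if "r \<in> K" for r
  proof -
    from that obtain g where "r = ker g" by (auto simp: K_def)
    then show ?thesis using count_kernel_poly[OF fin, of g] by (simp add: keq)
  qed
  then obtain P :: "_ \<Rightarrow> int poly" where
    P: "\<And>r n. r \<in> K \<Longrightarrow> poly (P r) (int n) = int (card {f \<in> X \<rightarrow>\<^sub>E {1..n}. ker f = r})"
    by metis
  have "poly (\<Sum>r\<in>K. P r) (int n) = int (card {f \<in> X \<rightarrow>\<^sub>E {1..n}. Q f})" for n
  proof -
    have "{f \<in> X \<rightarrow>\<^sub>E {1..n}. Q f} = (\<Union>r\<in>K. {f \<in> X \<rightarrow>\<^sub>E {1..n}. ker f = r})"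
      using Qk by (auto simp: K_def PiE_def)
    also have "card \<dots> = (\<Sum>r\<in>K. card {f \<in> X \<rightarrow>\<^sub>E {1..n}. ker f = r})"
      by (rule card_UN_disjoint) (use finK fin in \<open>auto intro!: finite_Collect_conjI finite_PiE\<close>)
    finally show ?thesis using P by (simp add: poly_sum)
  qed
  then show ?thesis by blast
qed

lemma poly_chromatic_poly:
  assumes "finite (pverts H)" "parcs H \<subseteq> pverts H \<times> pverts H" "n > 0"
  shows "poly (chromatic_poly H) (int n) = int (card (proper_colorings H n))"
proof -
  have "\<exists>P :: int poly. \<forall>n. poly P (int n) =
      int (card {c \<in> pverts H \<rightarrow>\<^sub>E {1..n}. \<forall>(u, v)\<in>parcs H. c u \<noteq> c v})"
  proof (rule ex_counting_poly[OF assms(1)])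
    fix f :: "'a \<Rightarrow> nat" and h :: "nat \<Rightarrow> nat"
    assume "inj_on h (f ` pverts H)" "\<forall>(u, v)\<in>parcs H. f u \<noteq> f v"
    then show "\<forall>(u, v)\<in>parcs H. restrict (h \<circ> f) (pverts H) u \<noteq> restrict (h \<circ> f) (pverts H) v"
      using assms(2) by (fastforce simp: inj_on_def)
  qed
  then obtain P :: "int poly" where
    P: "\<And>n. poly P (int n) = int (card (proper_colorings H n))"
    unfolding proper_colorings_def by blast
  then have "chromatic_poly H = P"
    unfolding chromatic_poly_def by (intro counting_poly_eqI)
  with P show ?thesis by simp
qed

lemma poly_PK_poly:
  assumes "cubic_graph G arev" "n > 0"
  shows "poly (PK_poly G arev M) (int n) = int (card (tait_colorings G arev M n))"
proof -
  let ?X = "edges G arev - M"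
  let ?Q = "\<lambda>c. \<forall>e\<in>arcs G. edge_of arev e \<in> M \<longrightarrow>
          (\<exists>i j. i \<noteq> j \<and> end_colors G arev M c (tail G e) = {i, j}
                    \<and> end_colors G arev M c (head G e) = {i, j})"
  have "finite ?X"
    using assms(1) by (auto simp: cubic_graph_def edges_def fin_digraph_def fin_digraph_axioms_def)
  have X: "edge_of arev a \<in> ?X" if "a \<in> free_ends G arev M" for a
    using that by (auto simp: free_ends_def edges_def)
  have img: "end_colors G arev M (restrict (h \<circ> f) ?X) v = h ` end_colors G arev M f v" for f h v
    using X unfolding end_colors_def image_image by (intro image_cong) auto
  have sub: "end_colors G arev M f v \<subseteq> f ` ?X" for f v
    using X unfolding end_colors_def by blast
  have "\<exists>P :: int poly. \<forall>n. poly P (int n) = int (card {c \<in> ?X \<rightarrow>\<^sub>E {1..n}. ?Q c})"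
  proof (rule ex_counting_poly[OF \<open>finite ?X\<close>], intro ballI impI)
    fix f :: "'b set \<Rightarrow> nat" and h :: "nat \<Rightarrow> nat" and e
    assume h: "inj_on h (f ` ?X)" and f: "?Q f" and e: "e \<in> arcs G" "edge_of arev e \<in> M"
    from f e obtain i j where ij: "i \<noteq> j" "end_colors G arev M f (tail G e) = {i, j}"
      "end_colors G arev M f (head G e) = {i, j}" by blast
    have "i \<in> f ` ?X" "j \<in> f ` ?X" using sub[of f "tail G e"] ij(2) by auto
    then have "h i \<noteq> h j" using h ij(1) by (auto dest: inj_onD)
    then show "\<exists>i j. i \<noteq> j \<and> end_colors G arev M (restrict (h \<circ> f) ?X) (tail G e) = {i, j}
        \<and> end_colors G arev M (restrict (h \<circ> f) ?X) (head G e) = {i, j}"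
      using ij(2,3) unfolding img by auto
  qed
  then obtain P :: "int poly" where
    P: "\<And>n. poly P (int n) = int (card (tait_colorings G arev M n))"
    unfolding tait_colorings_def by blast
  then have "PK_poly G arev M = P"
    unfolding PK_poly_def by (intro counting_poly_eqI)
  with P show ?thesis by simp
qed

end

theory Submission
  imports Defs
begin

text \<open>
  A Tait coloring determines a state: a matching edge is left crossed or gets smoothed according to
  which of the two pairings of its four surrounding edge-ends joins ends of equal color. The Tait
  colorings with a given state \<open>S\<close> are the edge colorings that are constant along the components of
  \<open>S\<close> and give different colors to the two arcs at every matching edge, that is, the proper
  colorings of the component graph. Since a component graph with a loop has no proper colorings,
  this holds for all states, colorable or not.
\<close>

text \<open>The iterates of \<open>f\<close> below the first return time to \<open>x\<close> list
  the orbit without repetition, so this return time equals the cardinality 3.\<close>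

lemma cyclic_on_card_3:
  assumes "cyclic_on f A" "card A = 3" "x \<in> A"
  shows "A = {x, f x, f (f x)}"
proof -
  have orb: "orbit f x = A" and x: "x \<in> orbit f x"
    using orbit_cyclic_eq3[OF assms(1,3)] assms(3) by simp_all
  have A: "A = (\<lambda>n. (f ^^ n) x) ` {0..<funpow_dist1 f x x}"
    using orbit_conv_funpow_dist1[OF x] orb by simp
  moreover have "inj_on (\<lambda>n. (f ^^ n) x) {0..<funpow_dist1 f x x}"
    using inj_on_funpow_dist1[OF x] .
  ultimately have "funpow_dist1 f x x = 3"
    using assms(2) by (simp only: card_image card_atLeastLessThan diff_zero)
  with A have "A = (\<lambda>n. (f ^^ n) x) ` {0, 1, 2}"
    by (metis atLeast0_lessThan_Suc eval_nat_numeral(3) insert_commute lessThan_0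
        lessThan_atLeast0 numeral_2_eq_2 One_nat_def)
  then show ?thesis
    by (simp add: numeral_2_eq_2)
qed

section \<open>Edge-ends around a matching edge\<close>

locale matched_cubic_ribbon_graph =
  fixes G :: "('a,'b) pre_digraph" and arev rot :: "'b \<Rightarrow> 'b" and M :: "'b set set"
  assumes cubic: "cubic_graph G arev"
    and matching: "perfect_matching G arev M"
    and rotation: "rotation_system G rot"
begin

sublocale fin_digraph G
  using cubic by (simp add: cubic_graph_def)

sublocale bidirected_digraph G arev
  using cubic by (simp add: cubic_graph_def)

abbreviation free :: "'b set" where
  "free \<equiv> free_ends G arev M"

abbreviation matched :: "'b \<Rightarrow> bool" where
  "matched e \<equiv> e \<in> arcs G \<and> edge_of arev e \<in> M"

abbreviation end_color :: "('b set \<Rightarrow> nat) \<Rightarrow> 'b \<Rightarrow> nat" where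
  "end_color f a \<equiv> f (edge_of arev a)"

lemma edge_of_arev [simp]: "edge_of arev (arev a) = edge_of arev a"
  by (auto simp: edge_of_def)

lemma arev_free: "a \<in> free \<Longrightarrow> arev a \<in> free"
  by (simp add: free_ends_def)

lemma edges_minus_matching: "edges G arev - M = edge_of arev ` free"
  by (auto simp: edges_def free_ends_def)

lemma finite_edges: "finite (edges G arev)"
  by (simp add: edges_def)

lemma finite_matching: "finite M"
  using matching finite_edges finite_subset by (auto simp: perfect_matching_def)

lemma matched_unique: "matched e \<Longrightarrow> matched e' \<Longrightarrow> tail G e = tail G e' \<Longrightarrow> e = e'"
  using matching by (fastforce simp: perfect_matching_def)

lemma matching_edgeE:
  assumes "E \<in> M"
  obtains e where "matched e" "E = edge_of arev e"
  using assms matching by (auto simp: perfect_matching_def edges_def)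

text \<open>At the tail of \<open>e\<close> the rotation is a 3-cycle and \<open>e\<close> is the
  only matched end, so the other two ends of the cycle are exactly the free ones.\<close>

lemma matched_rot:
  assumes "matched e"
  shows free_out_arcs: "out_arcs G (tail G e) \<inter> free = {rot e, rot (rot e)}"
    and rot_neq: "rot e \<noteq> rot (rot e)"
proof -
  have v: "tail G e \<in> verts G" and e: "e \<in> out_arcs G (tail G e)"
    using assms by simp_all
  have card: "card (out_arcs G (tail G e)) = 3"
    using cubic v by (simp add: cubic_graph_def out_degree_def)
  have "cyclic_on rot (out_arcs G (tail G e))"
    using rotation v by (simp add: rotation_system_def)
  from cyclic_on_card_3[OF this card e]
  have out: "out_arcs G (tail G e) = {e, rot e, rot (rot e)}" .
  with card have dist: "card {e, rot e, rot (rot e)} = 3"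
    by simp
  then have neq: "e \<noteq> rot e" "e \<noteq> rot (rot e)" "rot e \<noteq> rot (rot e)"
    by (auto simp: card_insert_if split: if_splits)
  then show "rot e \<noteq> rot (rot e)"
    by simp
  have "out_arcs G (tail G e) \<inter> free = out_arcs G (tail G e) - {e}"
    using matched_unique assms by (auto simp: free_ends_def)
  then show "out_arcs G (tail G e) \<inter> free = {rot e, rot (rot e)}"
    using out neq by auto
qed

lemma matched_arev: "matched e \<Longrightarrow> matched (arev e)"
  by simp

text \<open>A loop would put the two distinct matched ends \<open>e\<close> and
  \<open>arev e\<close> at one vertex.\<close>

lemma matched_not_loop:
  assumes "matched e"
  shows "tail G e \<noteq> head G e"
  using matched_unique[OF assms matched_arev[OF assms]] arev_neq[of e] assms by auto

text \<open>The inequalities hold because the ends compared sit at different vertices. They serve to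
  tell apart the two arcs that replace \<open>e\<close>.\<close>

lemma crossing_ends:
  assumes "matched e"
  shows "rot e \<in> free" "rot (rot e) \<in> free" "rot (arev e) \<in> free" "rot (rot (arev e)) \<in> free"
    and "rot (arev e) \<noteq> rot e" "rot (rot (arev e)) \<noteq> rot e"
proof -
  have u: "rot e \<in> out_arcs G (tail G e) \<inter> free" "rot (rot e) \<in> out_arcs G (tail G e) \<inter> free"
    using free_out_arcs[OF assms] by auto
  have w: "rot (arev e) \<in> out_arcs G (head G e) \<inter> free"
    "rot (rot (arev e)) \<in> out_arcs G (head G e) \<inter> free"
    using free_out_arcs[OF matched_arev[OF assms]] assms by auto
  show "rot e \<in> free" "rot (rot e) \<in> free" "rot (arev e) \<in> free" "rot (rot (arev e)) \<in> free"
    using u w by auto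
  show "rot (arev e) \<noteq> rot e" "rot (rot (arev e)) \<noteq> rot e"
    using u w matched_not_loop[OF assms] by auto
qed

section \<open>Sorting Tait colorings by state\<close>

text \<open>In both the crossed and the smoothed form, \<open>rot e\<close> and
  \<open>rot (rot e)\<close> lie on different arcs at \<open>e\<close>. Their inequality therefore
  says that the two arcs get different colors.\<close>

definition state_colorings :: "'b set set \<Rightarrow> nat \<Rightarrow> ('b set \<Rightarrow> nat) set" where
  "state_colorings S n =
     {f \<in> (edges G arev - M) \<rightarrow>\<^sub>E {1..n}.
        \<forall>e. matched e \<longrightarrow>
          end_color f (rot e) \<noteq> end_color f (rot (rot e)) \<and>
          (\<forall>x y. {x, y} \<in> state_arcs arev rot S e \<longrightarrow> end_color f x = end_color f y)}"

lemma arc_colors_eq_iff: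
  "(\<forall>x y. {x, y} \<in> state_arcs arev rot S e \<longrightarrow> end_color f x = end_color f y) \<longleftrightarrow>
   (if edge_of arev e \<in> S
    then end_color f (rot e) = end_color f (rot (rot (arev e))) \<and>
         end_color f (rot (rot e)) = end_color f (rot (arev e))
    else end_color f (rot e) = end_color f (rot (arev e)) \<and>
         end_color f (rot (rot e)) = end_color f (rot (rot (arev e))))"
  by (auto simp: state_arcs_def crossing_at_def doubleton_eq_iff)

lemma state_coloringsD:
  assumes "f \<in> state_colorings S n" "matched e"
  shows "end_color f (rot e) \<noteq> end_color f (rot (rot e))"
    and "if edge_of arev e \<in> S
      then end_color f (rot e) = end_color f (rot (rot (arev e))) \<and>
           end_color f (rot (rot e)) = end_color f (rot (arev e))
      else end_color f (rot e) = end_color f (rot (arev e)) \<and>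
           end_color f (rot (rot e)) = end_color f (rot (rot (arev e)))"
proof -
  have "end_color f (rot e) \<noteq> end_color f (rot (rot e)) \<and>
    (\<forall>x y. {x, y} \<in> state_arcs arev rot S e \<longrightarrow> end_color f x = end_color f y)"
    using assms unfolding state_colorings_def by blast
  then show "end_color f (rot e) \<noteq> end_color f (rot (rot e))"
    and "if edge_of arev e \<in> S
      then end_color f (rot e) = end_color f (rot (rot (arev e))) \<and>
           end_color f (rot (rot e)) = end_color f (rot (arev e))
      else end_color f (rot e) = end_color f (rot (arev e)) \<and>
           end_color f (rot (rot e)) = end_color f (rot (rot (arev e)))"
    unfolding arc_colors_eq_iff by blast+
qed

lemma end_colors_matched:
  assumes "matched e"
  shows "end_colors G arev M f (tail G e) = {end_color f (rot e), end_color f (rot (rot e))}"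
  by (simp add: end_colors_def free_out_arcs[OF assms])

text \<open>Equality of the two-element color sets at the endpoints of a matching edge leaves two
  ways to pair equal colors: one is the crossing, the other its smoothing.\<close>

lemma tait_colorings_eq_Union: "tait_colorings G arev M n = (\<Union>S\<in>Pow M. state_colorings S n)"
proof (intro set_eqI iffI)
  fix f assume f: "f \<in> tait_colorings G arev M n"
  \<comment> \<open>Smooth exactly the edges at which the parallel arcs join equal colors.\<close>
  define S where "S = {edge_of arev e | e. matched e \<and>
    end_color f (rot e) = end_color f (rot (rot (arev e))) \<and>
    end_color f (rot (rot e)) = end_color f (rot (arev e))}"
  \<comment> \<open>The choice of the end describing the edge does not matter: passing from
    \<open>e\<close> to \<open>arev e\<close> merely exchanges the two equations.\<close>
  have S: "edge_of arev e \<in> S \<longleftrightarrow> end_color f (rot e) = end_color f (rot (rot (arev e))) \<and>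
    end_color f (rot (rot e)) = end_color f (rot (arev e))" if "matched e" for e
  proof -
    have "e' = e \<or> e' = arev e" if "edge_of arev e' = edge_of arev e" for e'
      using that by (auto simp: edge_of_def doubleton_eq_iff)
    then show ?thesis
      using that by (fastforce simp: S_def)
  qed
  have "f \<in> state_colorings S n"
    unfolding state_colorings_def arc_colors_eq_iff
  proof (intro CollectI conjI allI impI)
    show "f \<in> (edges G arev - M) \<rightarrow>\<^sub>E {1..n}"
      using f by (simp add: tait_colorings_def)
    fix e assume e: "matched e"
    with f obtain i j where "i \<noteq> j" "end_colors G arev M f (tail G e) = {i, j}"
      "end_colors G arev M f (head G e) = {i, j}"
      by (auto simp: tait_colorings_def)
    then have ij: "i \<noteq> j" "{end_color f (rot e), end_color f (rot (rot e))} = {i, j}"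
      "{end_color f (rot (arev e)), end_color f (rot (rot (arev e)))} = {i, j}"
      using end_colors_matched[OF e, of f] end_colors_matched[OF matched_arev[OF e], of f] e
      by simp_all
    then show "end_color f (rot e) \<noteq> end_color f (rot (rot e))"
      by auto
    show "if edge_of arev e \<in> S
      then end_color f (rot e) = end_color f (rot (rot (arev e))) \<and>
           end_color f (rot (rot e)) = end_color f (rot (arev e))
      else end_color f (rot e) = end_color f (rot (arev e)) \<and>
           end_color f (rot (rot e)) = end_color f (rot (rot (arev e)))"
      \<comment> \<open>If the parallel pairing fails, equality of the two doubletons forces the
        crossed pairing.\<close>
      unfolding S[OF e] using ij by (auto simp: doubleton_eq_iff)
  qed
  moreover have "S \<subseteq> M"
    by (auto simp: S_def)
  ultimately show "f \<in> (\<Union>S\<in>Pow M. state_colorings S n)"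
    by blast
next
  fix f assume "f \<in> (\<Union>S\<in>Pow M. state_colorings S n)"
  then obtain S where f: "f \<in> state_colorings S n"
    by blast
  show "f \<in> tait_colorings G arev M n"
    unfolding tait_colorings_def
  proof (intro CollectI conjI ballI impI)
    show "f \<in> (edges G arev - M) \<rightarrow>\<^sub>E {1..n}"
      using f by (simp add: state_colorings_def)
    fix e assume "e \<in> arcs G" "edge_of arev e \<in> M"
    then have e: "matched e"
      by simp
    let ?i = "end_color f (rot e)" and ?j = "end_color f (rot (rot e))"
    have "?i \<noteq> ?j" "end_colors G arev M f (tail G e) = {?i, ?j}"
      using f e end_colors_matched[OF e] by (simp_all add: state_colorings_def)
    \<comment> \<open>The arcs carry both colors to the other endpoint, in an order that depends on
      whether the crossing is smoothed.\<close>
    moreover have "end_colors G arev M f (head G e) = {?i, ?j}"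
      using f e end_colors_matched[OF matched_arev[OF e], of f]
      by (auto simp: state_colorings_def arc_colors_eq_iff split: if_splits)
    ultimately show "\<exists>i j. i \<noteq> j \<and> end_colors G arev M f (tail G e) = {i, j} \<and>
      end_colors G arev M f (head G e) = {i, j}"
      by blast
  qed
qed

text \<open>At an edge of \<open>S\<close> outside \<open>S'\<close> both pairings would have equal
  colors, which forces \<open>rot e\<close> and \<open>rot (rot e)\<close> to agree in
  color.\<close>

lemma state_colorings_determine_state:
  assumes "f \<in> state_colorings S n" "f \<in> state_colorings S' n" "S \<subseteq> M"
  shows "S \<subseteq> S'"
proof
  fix E assume "E \<in> S"
  with assms(3) obtain e where "matched e" "E = edge_of arev e"
    using matching_edgeE by blast
  with assms(1,2) \<open>E \<in> S\<close> show "E \<in> S'"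
    using state_coloringsD[of f S n e] state_coloringsD[of f S' n e]
    by (auto split: if_splits)
qed

lemma finite_state_colorings: "finite (state_colorings S n)"
proof (rule finite_subset)
  show "state_colorings S n \<subseteq> (edges G arev - M) \<rightarrow>\<^sub>E {1..n}"
    unfolding state_colorings_def by blast
  show "finite ((edges G arev - M) \<rightarrow>\<^sub>E {1..n})"
    by (intro finite_PiE finite_Diff finite_edges) simp
qed

lemma card_tait_colorings:
  "card (tait_colorings G arev M n) = (\<Sum>S\<in>Pow M. card (state_colorings S n))"
  unfolding tait_colorings_eq_Union
  \<comment> \<open>A coloring shared by two states gives inclusions both ways, so distinct states
    have disjoint sets of colorings.\<close>
  using finite_matching finite_state_colorings state_colorings_determine_state
  by (intro card_UN_disjoint) (simp_all add: disjoint_iff, blast)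

section \<open>Components of a state and the component graph\<close>

context
  fixes S :: "'b set set"
begin

abbreviation step :: "'b rel" where
  "step \<equiv> state_step G arev rot M S"

abbreviation component :: "'b \<Rightarrow> 'b set" where
  "component a \<equiv> step\<^sup>* `` {a}"

lemma state_arc_subset_free: "matched e \<Longrightarrow> p \<in> state_arcs arev rot S e \<Longrightarrow> p \<subseteq> free"
  using crossing_ends[of e] by (auto simp: state_arcs_def crossing_at_def split: if_splits)

lemma step_free: "(a, b) \<in> step \<Longrightarrow> b \<in> free"
  using arev_free state_arc_subset_free by (fastforce simp: state_step_def)

lemma rtrancl_step_free: "(a, b) \<in> step\<^sup>* \<Longrightarrow> a \<in> free \<Longrightarrow> b \<in> free"
  by (induction rule: rtrancl_induct) (auto dest: step_free)

lemma sym_step: "sym step"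
  using arev_free by (auto simp: sym_def state_step_def insert_commute)

text \<open>Working on the whole type makes reflexivity automatic; by
  \<open>rtrancl_step_free\<close> the class of a free end still consists of free ends.\<close>

lemma equiv_step: "equiv UNIV (step\<^sup>*)"
  by (simp add: equiv_def refl_rtrancl sym_rtrancl[OF sym_step] trans_rtrancl)

lemma component_eq_iff: "component a = component b \<longleftrightarrow> (a, b) \<in> step\<^sup>*"
  using eq_equiv_class_iff[OF equiv_step] by simp

lemma components_eq: "components G arev rot M S = component ` free"
  by (auto simp: components_def quotient_def)

lemma component_of_mem:
  assumes "C \<in> components G arev rot M S" "a \<in> C"
  shows "C = component a" "a \<in> free"
  using assms component_eq_iff rtrancl_step_free by (auto simp: components_eq)

lemma components_mem: "a \<in> free \<Longrightarrow> component a \<in> components G arev rot M S"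
  by (simp add: components_eq)

lemma component_arev: "a \<in> free \<Longrightarrow> component (arev a) = component a"
  by (subst eq_commute, subst component_eq_iff) (auto simp: state_step_def)

lemma component_state_arc:
  assumes "matched e" "{a, b} \<in> state_arcs arev rot S e"
  shows "component a = component b" "{a, b} \<subseteq> component a"
proof -
  have "(a, b) \<in> step"
    using assms by (auto simp: state_step_def)
  then show "component a = component b" "{a, b} \<subseteq> component a"
    unfolding component_eq_iff by auto
qed

text \<open>Both ends of a free edge lie on the same curve. This gives a choice-free way to pass
  from an edge to its component.\<close>

lemma image_edge_of: "a \<in> free \<Longrightarrow> step\<^sup>* `` edge_of arev a = component a"
  using component_arev[of a] by (auto simp: edge_of_def)

lemma finite_components: "finite (components G arev rot M S)"
  using finite_subset[of free "arcs G"] by (auto simp: components_eq free_ends_def)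

text \<open>Each of the two arcs contains exactly one of \<open>rot e\<close> and
  \<open>rot (rot e)\<close>, and a component containing an arc is the class of any end on
  it.\<close>

lemma arcs_lie_in_iff:
  assumes "matched e" "C \<in> components G arev rot M S" "C' \<in> components G arev rot M S"
  shows "arcs_lie_in arev rot S e C C' \<longleftrightarrow>
    C = component (rot e) \<and> C' = component (rot (rot e)) \<or>
    C = component (rot (rot e)) \<and> C' = component (rot e)"
proof -
  \<comment> \<open>Here \<open>x\<close> and \<open>y\<close> are the two free ends at the other
    endpoint; smoothing exchanges their roles.\<close>
  obtain x y where xy: "state_arcs arev rot S e = {{rot e, x}, {rot (rot e), y}}" "rot e \<noteq> y"
    using crossing_ends[OF assms(1)]
    by (cases "edge_of arev e \<in> S") (auto simp: state_arcs_def crossing_at_def)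
  then have neq: "{rot e, x} \<noteq> {rot (rot e), y}"
    using rot_neq[OF assms(1)] by auto
  have sub: "{rot e, x} \<subseteq> component (rot e)" "{rot (rot e), y} \<subseteq> component (rot (rot e))"
    using component_state_arc(2)[OF assms(1)] xy(1) by blast+
  have "C = component (rot e) \<longleftrightarrow> {rot e, x} \<subseteq> C"
    "C = component (rot (rot e)) \<longleftrightarrow> {rot (rot e), y} \<subseteq> C"
    if "C \<in> components G arev rot M S" for C
    using sub component_of_mem(1)[OF that] by blast+
  then show ?thesis
    using assms(2,3) neq by (auto simp: arcs_lie_in_def xy(1))
qed

text \<open>This description is uniform in crossed and smoothed edges, and it covers non-colorable
  states, where some of the pairs are loops.\<close>

lemma parcs_component_graph:
  "parcs (component_graph G arev rot M S) =
    (\<Union>e\<in>{e. matched e}. {(component (rot e), component (rot (rot e))),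
                          (component (rot (rot e)), component (rot e))})"
  by (auto simp: component_graph_def cross_at_def kiss_at_def arcs_lie_in_iff
      components_mem crossing_ends)

section \<open>State colorings as proper colorings of the component graph\<close>

lemma end_color_rtrancl:
  assumes "f \<in> state_colorings S n" "(a, b) \<in> step\<^sup>*"
  shows "end_color f a = end_color f b"
  using assms(2)
proof (induction rule: rtrancl_induct)
  case (step b c)
  then have "end_color f b = end_color f c"
    using assms(1) by (auto simp: state_step_def state_colorings_def)
  with step show ?case by simp
qed simp

text \<open>State colorings are constant along components, so they correspond to colorings of the
  components; different colors on the two arcs at each matching edge become properness.\<close>

lemma card_state_colorings:
  "card (state_colorings S n) = card (proper_colorings (component_graph G arev rot M S) n)"
proof -
  \<comment> \<open>The color of a component is read off at an arbitrary end; by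
    \<open>end_color_rtrancl\<close> the choice is immaterial.\<close>
  let ?F = "\<lambda>f. \<lambda>C\<in>components G arev rot M S. end_color f (SOME a. a \<in> C)"
  let ?F' = "\<lambda>k. \<lambda>E\<in>edges G arev - M. k (step\<^sup>* `` E)"
  have F: "?F f (component a) = end_color f a" if "f \<in> state_colorings S n" "a \<in> free" for f a
  proof -
    have "(SOME b. b \<in> component a) \<in> component a"
      by (rule someI[of _ a]) simp
    then show ?thesis
      using end_color_rtrancl[OF that(1), of a] components_mem[OF that(2)] by simp
  qed
  have F': "end_color (?F' k) a = k (component a)" if "a \<in> free" for k a
    using that by (simp add: edges_minus_matching image_edge_of)
  have "bij_betw ?F (state_colorings S n) (proper_colorings (component_graph G arev rot M S) n)"
  proof (rule bij_betw_byWitness[where f' = ?F'])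
    show "\<forall>f\<in>state_colorings S n. ?F' (?F f) = f"
    proof
      fix f assume f: "f \<in> state_colorings S n"
      show "?F' (?F f) = f"
      proof (rule extensionalityI)
        show "f \<in> extensional (edges G arev - M)"
          using f by (simp add: state_colorings_def PiE_def)
        fix E assume "E \<in> edges G arev - M"
        then obtain a where "a \<in> free" "E = edge_of arev a"
          by (auto simp: edges_minus_matching)
        then show "?F' (?F f) E = f E"
          using F[OF f] F' by metis
      qed simp
    qed
    \<comment> \<open>Membership is isolated because evaluating \<open>?F (?F' k)\<close> by
      \<open>F\<close> also requires \<open>?F' k\<close> to be a state coloring.\<close>
    have F'_mem: "?F' k \<in> state_colorings S n"
      if k: "k \<in> proper_colorings (component_graph G arev rot M S) n" for k
      unfolding state_colorings_def
    proof (intro CollectI conjI allI impI)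
      have range: "k (component a) \<in> {1..n}" if "a \<in> free" for a
        using k components_mem[OF that]
        by (auto simp: proper_colorings_def component_graph_def simp del: atLeastAtMost_iff)
      show "?F' k \<in> (edges G arev - M) \<rightarrow>\<^sub>E {1..n}"
        using range by (auto simp: edges_minus_matching image_edge_of simp del: atLeastAtMost_iff)
      fix e assume e: "matched e"
      then have "(component (rot e), component (rot (rot e))) \<in>
          parcs (component_graph G arev rot M S)"
        by (auto simp: parcs_component_graph)
      then have "k (component (rot e)) \<noteq> k (component (rot (rot e)))"
        using k by (auto simp: proper_colorings_def)
      then show "end_color (?F' k) (rot e) \<noteq> end_color (?F' k) (rot (rot e))"
        by (simp add: F' crossing_ends(1,2)[OF e] del: restrict_apply)
      fix x y assume xy: "{x, y} \<in> state_arcs arev rot S e"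
      then have "x \<in> free" "y \<in> free"
        using state_arc_subset_free[OF e] by blast+
      then show "end_color (?F' k) x = end_color (?F' k) y"
        by (simp only: F' component_state_arc(1)[OF e xy])
    qed
    then show "?F' ` proper_colorings (component_graph G arev rot M S) n \<subseteq> state_colorings S n"
      by blast
    show "\<forall>k\<in>proper_colorings (component_graph G arev rot M S) n. ?F (?F' k) = k"
    proof
      fix k assume k: "k \<in> proper_colorings (component_graph G arev rot M S) n"
      show "?F (?F' k) = k"
      proof (rule extensionalityI)
        show "k \<in> extensional (components G arev rot M S)"
          using k by (simp add: proper_colorings_def component_graph_def PiE_def)
        fix C assume "C \<in> components G arev rot M S"
        then obtain a where "a \<in> free" "C = component a"
          by (auto simp: components_eq)
        then show "?F (?F' k) C = k C"
          using F[OF F'_mem[OF k]] F' by metis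
      qed simp
    qed
    show "?F ` state_colorings S n \<subseteq> proper_colorings (component_graph G arev rot M S) n"
    proof (rule image_subsetI)
      fix f assume f: "f \<in> state_colorings S n"
      have "?F f C \<in> {1..n}" if C: "C \<in> components G arev rot M S" for C
      proof -
        obtain a where a: "a \<in> free" "C = component a"
          using C by (auto simp: components_eq)
        have "edge_of arev a \<in> edges G arev - M"
          using a(1) by (simp add: edges_minus_matching)
        then have "end_color f a \<in> {1..n}"
          using f unfolding state_colorings_def by blast
        then show ?thesis
          using F[OF f a(1)] a(2) by simp
      qed
      then have "?F f \<in> components G arev rot M S \<rightarrow>\<^sub>E {1..n}"
        by (intro PiE_I) auto
      moreover have "?F f (component (rot e)) \<noteq> ?F f (component (rot (rot e)))" if "matched e" for e
        using state_coloringsD(1)[OF f that] F[OF f] crossing_ends(1,2)[OF that]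
        by (simp del: restrict_apply)
      then have "\<forall>(C, C')\<in>parcs (component_graph G arev rot M S). ?F f C \<noteq> ?F f C'"
        unfolding parcs_component_graph by (auto simp del: restrict_apply dest: sym)
      ultimately show "?F f \<in> proper_colorings (component_graph G arev rot M S) n"
        by (simp add: proper_colorings_def component_graph_def del: restrict_apply)
    qed
  qed
  then show ?thesis
    by (rule bij_betw_same_card)
qed

section \<open>Summation over states\<close>

text \<open>If both arcs at a matching edge lie in one component, the component graph has a loop
  there, and a proper coloring would need a color different from itself.\<close>

lemma not_colorable_no_proper_colorings:
  assumes "\<not> colorable G arev rot M S"
  shows "proper_colorings (component_graph G arev rot M S) n = {}"
proof -
  from assms obtain C where "(C, C) \<in> parcs (component_graph G arev rot M S)"
    by (auto simp: colorable_def component_graph_def cross_at_def kiss_at_def)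
  then show ?thesis
    by (auto simp: proper_colorings_def)
qed

lemma poly_chromatic_component_graph:
  assumes "n > 0"
  shows "poly (chromatic_poly (component_graph G arev rot M S)) (int n) =
    int (card (proper_colorings (component_graph G arev rot M S) n))"
  using finite_components assms
  by (intro poly_chromatic_poly) (auto simp: component_graph_def)

end

text \<open>A counting polynomial is determined by its values at positive integers, so it suffices
  to compare numbers of colorings.\<close>

lemma PK_poly_eq_sum:
  "PK_poly G arev M =
    (\<Sum>S | S \<subseteq> M \<and> colorable G arev rot M S. chromatic_poly (component_graph G arev rot M S))"
  unfolding PK_poly_def
proof (rule counting_poly_eqI)
  fix n :: nat assume n: "n > 0"
  let ?p = "\<lambda>S. card (proper_colorings (component_graph G arev rot M S) n)"
  have "card (tait_colorings G arev M n) = (\<Sum>S\<in>Pow M. ?p S)"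
    by (simp add: card_tait_colorings card_state_colorings)
  also have "\<dots> = (\<Sum>S | S \<subseteq> M \<and> colorable G arev rot M S. ?p S)"
    using finite_matching not_colorable_no_proper_colorings
    by (intro sum.mono_neutral_right) auto
  finally show "poly (\<Sum>S | S \<subseteq> M \<and> colorable G arev rot M S.
      chromatic_poly (component_graph G arev rot M S)) (int n) =
    int (card (tait_colorings G arev M n))"
    by (simp add: poly_sum poly_chromatic_component_graph[OF n])
qed

end

theorem theorem3p4:
  fixes G :: "('a,'b) pre_digraph" and arev rot :: "'b \<Rightarrow> 'b" and M :: "'b set set"
  assumes "cubic_graph G arev"
    and "perfect_matching G arev M"
    and "rotation_system G rot"
  shows "PK_poly G arev M =
    (\<Sum>S | S \<subseteq> M \<and> colorable G arev rot M S. chromatic_poly (component_graph G arev rot M S))"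
proof -
  interpret matched_cubic_ribbon_graph G arev rot M
    using assms by unfold_locales
  show ?thesis
    by (rule PK_poly_eq_sum)
qed

end
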